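(* Let $X$ and $Y$ be topological spaces, let $Y$ be $Q^*$-normal, and let $f:X\to Y$ be an almost $Q^*g$-continuous injection. (a) If $f$ is pre-$Q^*$-closed, then $X$ is $Q^*$-normal. (b) If $f$ is $Q^*$-closed, then $X$ is normal.
   Context: No separation axioms are assumed on topological spaces, and functions are not assumed continuous unless stated. The symbol $\subset$ denotes (not necessarily proper) inclusion; $cl(A)$ and $int(A)$ denote closure and interior. A subset $A$ of a space is regular open if $A=int(cl(A))$. A subset $A$ of $X$ is $Q^*$-closed if $A$ is closed and $int(A)=\emptyset$; $A$ is $Q^*$-open if $X-A$ is $Q^*$-closed. A subset $A$ of $X$ is $Q^*g$-closed if $cl(A)\subset W$ whenever $A\subset W$ and $W$ is $Q^*$-open in $X$; it is $Q^*g$-open if $X-A$ is $Q^*g$-closed. A space $X$ is $Q^*$-normal if any two disjoint $Q^*$-closed subsets of $X$ are contained in disjoint open sets of $X$; it is normal if any two disjoint closed subsets are contained in disjoint open sets (no $T_1$ assumption). A function $f:X\to Y$ is: almost $Q^*g$-continuous if $f^{-1}(V)$ is $Q^*g$-open in $X$ for every regular open set $V$ of $Y$; pre-$Q^*$-closed if $f(F)$ is $Q^*$-closed in $Y$ for every $Q^*$-closed set $F$ of $X$; $Q^*$-closed if $f(F)$ is $Q^*$-closed in $Y$ for every closed set $F$ of $X$. *)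

theory Defs
  imports "HOL-Analysis.Analysis"
begin

text \<open>
  Spaces are abstract topologies, so subsets are subsets of the carrier \<open>topspace X\<close>,
  complements are relative to it, and it may be empty.
\<close>

definition regular_open_in :: "'a topology \<Rightarrow> 'a set \<Rightarrow> bool" where
  "regular_open_in X A \<longleftrightarrow> A \<subseteq> topspace X \<and> A = X interior_of (X closure_of A)"

definition Qstar_closedin :: "'a topology \<Rightarrow> 'a set \<Rightarrow> bool" where
  "Qstar_closedin X A \<longleftrightarrow> closedin X A \<and> X interior_of A = {}"

definition Qstar_openin :: "'a topology \<Rightarrow> 'a set \<Rightarrow> bool" where
  "Qstar_openin X A \<longleftrightarrow> A \<subseteq> topspace X \<and> Qstar_closedin X (topspace X - A)"

definition Qstar_g_closedin :: "'a topology \<Rightarrow> 'a set \<Rightarrow> bool" where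
  "Qstar_g_closedin X A \<longleftrightarrow>
     A \<subseteq> topspace X \<and> (\<forall>W. A \<subseteq> W \<and> Qstar_openin X W \<longrightarrow> X closure_of A \<subseteq> W)"

definition Qstar_g_openin :: "'a topology \<Rightarrow> 'a set \<Rightarrow> bool" where
  "Qstar_g_openin X A \<longleftrightarrow> A \<subseteq> topspace X \<and> Qstar_g_closedin X (topspace X - A)"

definition Qstar_normal_space :: "'a topology \<Rightarrow> bool" where
  "Qstar_normal_space X \<longleftrightarrow>
     (\<forall>S T. Qstar_closedin X S \<and> Qstar_closedin X T \<and> disjnt S T \<longrightarrow>
        (\<exists>U V. openin X U \<and> openin X V \<and> S \<subseteq> U \<and> T \<subseteq> V \<and> disjnt U V))"

text \<open>
  The following predicates do not include that \<open>f\<close> maps \<open>topspace X\<close> into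
  \<open>topspace Y\<close>; this is to be assumed separately.
\<close>

definition almost_Qstar_g_continuous_map ::
    "'a topology \<Rightarrow> 'b topology \<Rightarrow> ('a \<Rightarrow> 'b) \<Rightarrow> bool" where
  "almost_Qstar_g_continuous_map X Y f \<longleftrightarrow>
     (\<forall>V. regular_open_in Y V \<longrightarrow> Qstar_g_openin X {x \<in> topspace X. f x \<in> V})"

definition pre_Qstar_closed_map :: "'a topology \<Rightarrow> 'b topology \<Rightarrow> ('a \<Rightarrow> 'b) \<Rightarrow> bool" where
  "pre_Qstar_closed_map X Y f \<longleftrightarrow>
     (\<forall>F. Qstar_closedin X F \<longrightarrow> Qstar_closedin Y (f ` F))"

definition Qstar_closed_map :: "'a topology \<Rightarrow> 'b topology \<Rightarrow> ('a \<Rightarrow> 'b) \<Rightarrow> bool" where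
  "Qstar_closed_map X Y f \<longleftrightarrow>
     (\<forall>F. closedin X F \<longrightarrow> Qstar_closedin Y (f ` F))"

end

theory Submission
  imports Defs
begin

text \<open>
  Disjoint open sets have disjoint regular open hulls, so disjoint closed sets with
  \<open>Q\<^sup>*\<close>-closed images lie in disjoint \<open>Q\<^sup>*g\<close>-open preimages. A closed set inside a
  \<open>Q\<^sup>*g\<close>-open set already lies in its interior: its frontier is \<open>Q\<^sup>*\<close>-closed, which
  handles the frontier points, and its interior points are harmless. Thus in (b) the closed
  sets themselves need not be \<open>Q\<^sup>*\<close>-closed.
\<close>

text \<open>The complement of \<open>S\<close> is Q*-open and contains the complement of
  \<open>G\<close>, so it also contains the closure of the latter; take complements.\<close>

lemma Qstar_closedin_subset_interior_of:
  assumes "Qstar_closedin X S" "Qstar_g_openin X G" "S \<subseteq> G"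
  shows "S \<subseteq> X interior_of G"
proof -
  have S: "S \<subseteq> topspace X"
    using assms(1) by (simp add: Qstar_closedin_def closedin_subset)
  then have "topspace X - (topspace X - S) = S"
    by blast
  then have "Qstar_openin X (topspace X - S)"
    using assms(1) by (simp add: Qstar_openin_def)
  then have "X closure_of (topspace X - G) \<subseteq> topspace X - S"
    using assms(2,3) unfolding Qstar_g_openin_def Qstar_g_closedin_def by blast
  then show ?thesis
    using S by (auto simp: interior_of_closure_of)
qed

text \<open>An open set inside the difference is an open subset of \<open>S\<close>, hence lies in
  the interior that was removed, so it is empty.\<close>

lemma Qstar_closedin_closed_diff_interior_of:
  assumes "closedin X S"
  shows "Qstar_closedin X (S - X interior_of S)"
proof -
  have "X interior_of (S - X interior_of S) \<subseteq> X interior_of S"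
    by (rule interior_of_mono) blast
  moreover have "X interior_of (S - X interior_of S) \<subseteq> S - X interior_of S"
    by (rule interior_of_subset)
  ultimately show ?thesis
    using assms by (auto simp: Qstar_closedin_def closedin_diff)
qed

lemma closedin_subset_interior_of_Qstar_g_openin:
  assumes "closedin X S" "Qstar_g_openin X G" "S \<subseteq> G"
  shows "S \<subseteq> X interior_of G"
proof -
  have "S - X interior_of S \<subseteq> X interior_of G"
    using Qstar_closedin_subset_interior_of[OF Qstar_closedin_closed_diff_interior_of] assms
    by blast
  moreover have "X interior_of S \<subseteq> X interior_of G"
    using assms(3) by (rule interior_of_mono)
  ultimately show ?thesis
    by blast
qed

lemma regular_open_in_interior_of_closure_of:
  "regular_open_in X (X interior_of (X closure_of U))"
proof -
  let ?R = "X interior_of (X closure_of U)"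
  have "X closure_of ?R \<subseteq> X closure_of U"
    by (simp add: closure_of_minimal interior_of_subset)
  then have "X interior_of (X closure_of ?R) \<subseteq> ?R"
    by (rule interior_of_mono)
  moreover have "?R \<subseteq> X interior_of (X closure_of ?R)"
    by (simp add: interior_of_maximal closure_of_subset interior_of_subset_topspace)
  ultimately show ?thesis
    by (auto simp: regular_open_in_def interior_of_subset_topspace[THEN subsetD])
qed

text \<open>An open set that misses a set misses its closure. This is used twice: for
  \<open>V\<close> against \<open>U\<close>, then for the open hull of \<open>U\<close> against
  \<open>V\<close>.\<close>

lemma disjnt_interior_of_closure_of:
  assumes "openin X U" "openin X V" "disjnt U V"
  shows "disjnt (X interior_of (X closure_of U)) (X interior_of (X closure_of V))"
proof -
  let ?R = "X interior_of (X closure_of U)"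
  have "V \<inter> X closure_of U = {}"
    using assms by (simp add: openin_Int_closure_of_eq_empty disjnt_def Int_commute)
  then have "?R \<inter> V = {}"
    using interior_of_subset[of X "X closure_of U"] by blast
  then have "?R \<inter> X closure_of V = {}"
    by (simp add: openin_Int_closure_of_eq_empty)
  then show ?thesis
    using interior_of_subset[of X "X closure_of V"] by (auto simp: disjnt_def)
qed

text \<open>The common core of both parts, which differ only in the closed sets whose images are
  known to be Q*-closed.\<close>

lemma separation_from_Qstar_closed_images:
  assumes Y: "Qstar_normal_space Y"
    and inj: "inj_on f (topspace X)"
    and cont: "almost_Qstar_g_continuous_map X Y f"
    and S: "closedin X S" "Qstar_closedin Y (f ` S)"
    and T: "closedin X T" "Qstar_closedin Y (f ` T)"
    and "disjnt S T"
  shows "\<exists>U V. openin X U \<and> openin X V \<and> S \<subseteq> U \<and> T \<subseteq> V \<and> disjnt U V"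
proof -
  have sub: "S \<subseteq> topspace X" "T \<subseteq> topspace X"
    using S T by (simp_all add: closedin_subset)
  have "disjnt (f ` S) (f ` T)"
    using inj sub \<open>disjnt S T\<close> by (auto simp: disjnt_def dest: inj_onD)
  then obtain U V where UV: "openin Y U" "openin Y V" "f ` S \<subseteq> U" "f ` T \<subseteq> V" "disjnt U V"
    using Y S(2) T(2) unfolding Qstar_normal_space_def by metis
  \<comment> \<open>Almost continuity speaks only of regular open sets, so the open sets
    \<open>U\<close> and \<open>V\<close> are enlarged to their regular open hulls before pulling
    back.\<close>
  define R where "R W = Y interior_of (Y closure_of W)" for W
  define G where "G W = {x \<in> topspace X. f x \<in> R W}" for W
  have G: "Qstar_g_openin X (G W)" for W
    using cont regular_open_in_interior_of_closure_of
    unfolding almost_Qstar_g_continuous_map_def G_def R_def by blast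
  have R: "W \<subseteq> R W" if "openin Y W" for W
    using that by (simp add: R_def interior_of_maximal closure_of_subset openin_subset)
  have "S \<subseteq> G U" "T \<subseteq> G V"
    using sub UV R unfolding G_def by blast+
  \<comment> \<open>The preimages need not be open; closedness of \<open>S\<close> and
    \<open>T\<close> allows passing to their interiors.\<close>
  then have "S \<subseteq> X interior_of G U" "T \<subseteq> X interior_of G V"
    using S(1) T(1) G by (simp_all add: closedin_subset_interior_of_Qstar_g_openin)
  moreover have "disjnt (X interior_of G U) (X interior_of G V)"
  proof -
    have "disjnt (G U) (G V)"
      using disjnt_interior_of_closure_of[OF UV(1,2,5)]
      by (auto simp: G_def R_def disjnt_def)
    then show ?thesis
      by (meson disjnt_subset1 disjnt_subset2 interior_of_subset)
  qed
  ultimately show ?thesis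
    by (meson openin_interior_of)
qed

theorem theorem3p6:
  fixes X :: "'a topology" and Y :: "'b topology" and f :: "'a \<Rightarrow> 'b"
  assumes "Qstar_normal_space Y"
    and "f \<in> topspace X \<rightarrow> topspace Y"
    and "inj_on f (topspace X)"
    and "almost_Qstar_g_continuous_map X Y f"
  shows "(pre_Qstar_closed_map X Y f \<longrightarrow> Qstar_normal_space X)
       \<and> (Qstar_closed_map X Y f \<longrightarrow> normal_space X)"
proof (intro conjI impI)
  note separation = separation_from_Qstar_closed_images[OF assms(1,3,4)]
  \<comment> \<open>Q*-closed sets are closed, and here their images are Q*-closed.\<close>
  show "Qstar_normal_space X" if "pre_Qstar_closed_map X Y f"
    using that separation
    by (simp add: Qstar_normal_space_def pre_Qstar_closed_map_def Qstar_closedin_def)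
  show "normal_space X" if "Qstar_closed_map X Y f"
    using that separation by (simp add: normal_space_def Qstar_closed_map_def)
qed

end
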